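(* Let $S$ be a skew lattice. Then $S$ is normal if and only if for each comparable pair of $\mathcal D$-classes $A>B$ in $S$ and all $x,x'\in B$ the following two implications hold: (i) if $x\mathrel{\mathcal L}x'$ then $A\land x=A\land x'$; (ii) if $x\mathrel{\mathcal R}x'$ then $x\land A=x'\land A$. Dually, $S$ is conormal if and only if for each comparable pair of $\mathcal D$-classes $A>B$ in $S$ and all $x,x'\in A$ the following two implications hold: (iii) if $x\mathrel{\mathcal R}x'$ then $B\lor x=B\lor x'$; (iv) if $x\mathrel{\mathcal L}x'$ then $x\lor B=x'\lor B$.
   Context: A skew lattice is an algebra $(S;\lor,\land)$ where $\land,\lor$ are idempotent associative binary operations satisfying $x\land(x\lor y)=x=(y\lor x)\land x$ and $x\lor(x\land y)=x=(y\land x)\lor x$. Green's relations: $x\mathrel{\mathcal L}y$ iff $x\land y=x$ and $y\land x=y$ (dually $x\lor y=y$ and $y\lor x=x$); $x\mathrel{\mathcal R}y$ iff $x\land y=y$ and $y\land x=x$ (dually $x\lor y=x$ and $y\lor x=y$); $x\mathrel{\mathcal D}y$ iff $x\land y\land x=x$ and $y\land x\land y=y$. $\mathcal D$ is a congruence, $S/\mathcal D$ is a lattice, and for $\mathcal D$-classes $A>B$ means $A>B$ in $S/\mathcal D$. For $\mathcal D$-classes $A>B$, $x\in B$, $u\in A$: $A\land x=\{a\land x:a\in A\}$, $x\land A=\{x\land a:a\in A\}$, $B\lor u=\{b\lor u:b\in B\}$, $u\lor B=\{u\lor b:b\in B\}$. $S$ is normal if it satisfies $x\land y\land z\land w=x\land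 z\land y\land w$, and conormal if it satisfies $x\lor y\lor z\lor w=x\lor z\lor y\lor w$. *)

theory Defs
  imports Main
begin

locale skew_lattice =
  join: semigroup join + meet: semigroup meet
  for join :: "'a \<Rightarrow> 'a \<Rightarrow> 'a" (infixl "\<squnion>" 65)
    and meet :: "'a \<Rightarrow> 'a \<Rightarrow> 'a" (infixl "\<sqinter>" 70) +
  assumes join_idem: "x \<squnion> x = x"
    and meet_idem: "x \<sqinter> x = x"
    and meet_join_absorb_left: "x \<sqinter> (x \<squnion> y) = x"
    and meet_join_absorb_right: "(y \<squnion> x) \<sqinter> x = x"
    and join_meet_absorb_left: "x \<squnion> (x \<sqinter> y) = x"
    and join_meet_absorb_right: "(y \<sqinter> x) \<squnion> x = x"

text \<open>Green's relations of a skew lattice are by convention those of its meet band.\<close>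

definition greenL :: "('a \<Rightarrow> 'a \<Rightarrow> 'a) \<Rightarrow> 'a rel" where
  "greenL meet = {(x, y). meet x y = x \<and> meet y x = y}"

definition greenR :: "('a \<Rightarrow> 'a \<Rightarrow> 'a) \<Rightarrow> 'a rel" where
  "greenR meet = {(x, y). meet x y = y \<and> meet y x = x}"

definition greenD :: "('a \<Rightarrow> 'a \<Rightarrow> 'a) \<Rightarrow> 'a rel" where
  "greenD meet = {(x, y). meet (meet x y) x = x \<and> meet (meet y x) y = y}"

definition normal_op :: "('a \<Rightarrow> 'a \<Rightarrow> 'a) \<Rightarrow> bool" where
  "normal_op f \<longleftrightarrow> (\<forall>x y z w. f (f (f x y) z) w = f (f (f x z) y) w)"

abbreviation D_classes :: "('a \<Rightarrow> 'a \<Rightarrow> 'a) \<Rightarrow> 'a set set" where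
  "D_classes meet \<equiv> UNIV // greenD meet"

text \<open>The operation induced on \<open>\<D>\<close>-classes by an operation \<open>f\<close>; as \<open>\<D>\<close> is a congruence, the
  sets united are all the same class (see \<open>class_op_classes\<close> below).\<close>

definition class_op :: "('a \<Rightarrow> 'a \<Rightarrow> 'a) \<Rightarrow> ('a \<Rightarrow> 'a \<Rightarrow> 'a) \<Rightarrow> 'a set \<Rightarrow> 'a set \<Rightarrow> 'a set" where
  "class_op meet f A B = (\<Union>a\<in>A. \<Union>b\<in>B. greenD meet `` {f a b})"

text \<open>The strict order of the lattice of \<open>\<D>\<close>-classes, meant for arguments in
  \<^term>\<open>D_classes meet\<close>.\<close>

definition class_gt :: "('a \<Rightarrow> 'a \<Rightarrow> 'a) \<Rightarrow> 'a set \<Rightarrow> 'a set \<Rightarrow> bool" where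
  "class_gt meet A B \<longleftrightarrow> class_op meet meet A B = B \<and> A \<noteq> B"

context skew_lattice
begin

lemma greenL_iff_join: "(x, y) \<in> greenL meet \<longleftrightarrow> x \<squnion> y = y \<and> y \<squnion> x = x"
proof -
  have "x \<squnion> y = y" if "x \<sqinter> y = x" for x y
    using join_meet_absorb_right[of x y] that by simp
  moreover have "x \<sqinter> y = x" if "x \<squnion> y = y" for x y
    using meet_join_absorb_left[of x y] that by simp
  ultimately show ?thesis
    unfolding greenL_def by blast
qed

lemma greenR_iff_join: "(x, y) \<in> greenR meet \<longleftrightarrow> x \<squnion> y = x \<and> y \<squnion> x = y"
proof -
  have "x \<squnion> y = x" if "x \<sqinter> y = y" for x y
    using join_meet_absorb_left[of x y] that by simp
  moreover have "x \<sqinter> y = y" if "x \<squnion> y = x" for x y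
    using meet_join_absorb_right[of x y] that by simp
  ultimately show ?thesis
    unfolding greenR_def by blast
qed

lemma meet_aba_trans:
  assumes xyx: "x \<sqinter> y \<sqinter> x = x" and yzy: "y \<sqinter> z \<sqinter> y = y"
  shows "x \<sqinter> z \<sqinter> x = x"
proof -
  note A = meet.assoc
  have I: "a \<sqinter> (a \<sqinter> b) = a \<sqinter> b" for a b by (metis A meet_idem)
  have x: "x = x \<sqinter> y \<sqinter> z \<sqinter> y \<sqinter> x" using xyx yzy by (metis A)
  let ?u = "x \<sqinter> y" and ?v = "y \<sqinter> x"
  have x': "x = ?u \<sqinter> (z \<sqinter> ?v)" using x by (simp add: A)
  have r: "x \<sqinter> (z \<sqinter> ?v) = x"
  proof -
    have "x \<sqinter> (z \<sqinter> ?v) = (?u \<sqinter> (z \<sqinter> ?v)) \<sqinter> (z \<sqinter> ?v)" using x' by metis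
    also have "\<dots> = ?u \<sqinter> (z \<sqinter> ?v)" by (simp only: A[of ?u "z \<sqinter> ?v"] meet_idem)
    finally show ?thesis using x' by metis
  qed
  have l: "(?u \<sqinter> z) \<sqinter> x = x"
  proof -
    have "(?u \<sqinter> z) \<sqinter> x = (?u \<sqinter> z) \<sqinter> ((?u \<sqinter> z) \<sqinter> ?v)" using x' A by metis
    also have "\<dots> = (?u \<sqinter> z) \<sqinter> ?v" by (rule I)
    finally show ?thesis using x' A by metis
  qed
  define w where "w = ?v \<sqinter> ?u"
  have xx: "x = (x \<sqinter> z) \<sqinter> (w \<sqinter> (z \<sqinter> x))"
  proof -
    have "x = (x \<sqinter> (z \<sqinter> ?v)) \<sqinter> ((?u \<sqinter> z) \<sqinter> x)" by (simp only: r l meet_idem)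
    then show ?thesis by (simp only: A w_def)
  qed
  have "(x \<sqinter> z) \<sqinter> x = (x \<sqinter> z) \<sqinter> ((x \<sqinter> z) \<sqinter> (w \<sqinter> (z \<sqinter> x)))" using xx by metis
  also have "\<dots> = x" using xx I by metis
  finally show ?thesis .
qed

lemma meet_aba_glb:
  "z \<sqinter> (x \<sqinter> y) \<sqinter> z = z \<longleftrightarrow> z \<sqinter> x \<sqinter> z = z \<and> z \<sqinter> y \<sqinter> z = z"
proof -
  note A = meet.assoc
  have I: "a \<sqinter> (a \<sqinter> b) = a \<sqinter> b" for a b by (metis A meet_idem)
  have 1: "(x \<sqinter> y) \<sqinter> x \<sqinter> (x \<sqinter> y) = x \<sqinter> y"
    using meet_idem[of "x \<sqinter> y"] by (simp only: A I)
  have 2: "(x \<sqinter> y) \<sqinter> y \<sqinter> (x \<sqinter> y) = x \<sqinter> y"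
    using meet_idem[of "x \<sqinter> y"] by (simp only: A I)
  have "z \<sqinter> (x \<sqinter> y) \<sqinter> z = z" if zx: "z \<sqinter> x \<sqinter> z = z" and zy: "z \<sqinter> y \<sqinter> z = z"
  proof -
    have "z = (z \<sqinter> y \<sqinter> z) \<sqinter> (z \<sqinter> x \<sqinter> z)"
      by (simp only: zx zy meet_idem)
    then have "z \<sqinter> (y \<sqinter> z \<sqinter> x) \<sqinter> z = z"
      by (simp only: A I)
    moreover have "(y \<sqinter> z \<sqinter> x) \<sqinter> (x \<sqinter> y) \<sqinter> (y \<sqinter> z \<sqinter> x) = y \<sqinter> z \<sqinter> x"
      using meet_idem[of "y \<sqinter> z \<sqinter> x"] by (simp only: A I)
    ultimately show ?thesis by (rule meet_aba_trans)
  qed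
  then show ?thesis
    using meet_aba_trans[OF _ 1] meet_aba_trans[OF _ 2] by blast
qed

lemma meet_aba_imp_join_aba:
  assumes "x \<sqinter> y \<sqinter> x = x"
  shows "y \<squnion> x \<squnion> y = y"
proof -
  have "x \<squnion> (y \<sqinter> x) = y \<sqinter> x"
    using join_meet_absorb_right[of x "y \<sqinter> x"] assms by (simp add: meet.assoc)
  then have y: "(y \<squnion> x) \<squnion> (y \<sqinter> x) = y"
    by (simp add: join.assoc join_meet_absorb_left)
  have "(y \<squnion> x) \<squnion> y = (y \<squnion> x) \<squnion> ((y \<squnion> x) \<squnion> (y \<sqinter> x))"
    by (simp only: y)
  also have "\<dots> = (y \<squnion> x) \<squnion> (y \<sqinter> x)"
    by (simp only: join.assoc[of "y \<squnion> x" "y \<squnion> x", symmetric] join_idem)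
  finally show ?thesis by (simp only: y)
qed

lemma dual_skew_lattice: "skew_lattice (\<sqinter>) (\<squnion>)"
  by unfold_locales
    (rule meet_idem join_idem meet_join_absorb_left meet_join_absorb_right
      join_meet_absorb_left join_meet_absorb_right)+

lemma meet_aba_iff_join_aba: "x \<sqinter> y \<sqinter> x = x \<longleftrightarrow> y \<squnion> x \<squnion> y = y"
  using meet_aba_imp_join_aba skew_lattice.meet_aba_imp_join_aba[OF dual_skew_lattice] by blast

lemma greenD_iff_join: "(x, y) \<in> greenD meet \<longleftrightarrow> x \<squnion> y \<squnion> x = x \<and> y \<squnion> x \<squnion> y = y"
  unfolding greenD_def using meet_aba_iff_join_aba by auto

lemma equiv_greenD: "equiv UNIV (greenD meet)"
proof (rule equivI)
  show "refl (greenD meet)"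
    by (simp add: refl_on_def greenD_def meet_idem)
  show "sym (greenD meet)"
    by (auto simp: sym_def greenD_def)
  show "trans (greenD meet)"
    unfolding trans_def greenD_def using meet_aba_trans by blast
qed simp

lemma greenD_meet_cong:
  assumes "(x, x') \<in> greenD meet" "(y, y') \<in> greenD meet"
  shows "(x \<sqinter> y, x' \<sqinter> y') \<in> greenD meet"
proof -
  have "a \<sqinter> b \<sqinter> (a' \<sqinter> b') \<sqinter> (a \<sqinter> b) = a \<sqinter> b"
    if "a \<sqinter> a' \<sqinter> a = a" "b \<sqinter> b' \<sqinter> b = b" for a a' b b'
  proof -
    have "a \<sqinter> b \<sqinter> (a \<sqinter> b) \<sqinter> (a \<sqinter> b) = a \<sqinter> b"
      by (simp only: meet_idem)
    then have "a \<sqinter> b \<sqinter> a \<sqinter> (a \<sqinter> b) = a \<sqinter> b" "a \<sqinter> b \<sqinter> b \<sqinter> (a \<sqinter> b) = a \<sqinter> b"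
      using meet_aba_glb by blast+
    then have "a \<sqinter> b \<sqinter> a' \<sqinter> (a \<sqinter> b) = a \<sqinter> b" "a \<sqinter> b \<sqinter> b' \<sqinter> (a \<sqinter> b) = a \<sqinter> b"
      using that meet_aba_trans by blast+
    then show ?thesis
      using meet_aba_glb by blast
  qed
  then show ?thesis
    using assms by (auto simp: greenD_def)
qed

lemma greenD_join_cong:
  assumes "(x, x') \<in> greenD meet" "(y, y') \<in> greenD meet"
  shows "(x \<squnion> y, x' \<squnion> y') \<in> greenD meet"
  using skew_lattice.greenD_meet_cong[OF dual_skew_lattice, of x x' y y'] assms
  unfolding greenD_iff_join skew_lattice.greenD_iff_join[OF dual_skew_lattice]
  by (simp add: meet_aba_iff_join_aba)

lemma class_op_classes:
  "class_op meet meet (greenD meet `` {x}) (greenD meet `` {y}) = greenD meet `` {x \<sqinter> y}"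
  "class_op meet join (greenD meet `` {x}) (greenD meet `` {y}) = greenD meet `` {x \<squnion> y}"
  unfolding class_op_def
  by (rule UN_equiv_class2[OF equiv_greenD equiv_greenD];
      auto intro!: congruent2I' equiv_class_eq[OF equiv_greenD] greenD_meet_cong greenD_join_cong)+

end

end

theory Submission
  imports Defs
begin

text \<open>In a normal band, \<open>x \<L> x'\<close> already gives \<open>a \<sqinter> x = a \<sqinter> x'\<close> for every \<open>a\<close>, and dually for \<open>\<R>\<close>.
  Conversely, let \<open>b, b'\<close> lie below \<open>a\<close> in the natural order with \<open>b \<L> b'\<close>. By (i) we may write
  \<open>b = c \<sqinter> b'\<close> with \<open>c \<D> a\<close>, so \<open>b' = a \<sqinter> b' = a \<sqinter> c \<sqinter> a \<sqinter> b' = a \<sqinter> b = b\<close>; likewise for \<open>\<R>\<close> by (ii).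
  As \<open>b \<R> b \<sqinter> b' \<L> b'\<close> whenever \<open>b \<D> b'\<close>, every \<open>\<D>\<close>-class has at most one element
  below \<open>a\<close>. Hence \<open>x \<sqinter> y \<sqinter> z \<sqinter> x = x \<sqinter> z \<sqinter> y \<sqinter> x\<close>, which is equivalent to normality. The
  statement on \<open>\<squnion>\<close> is the one on \<open>\<sqinter>\<close> in the dual skew lattice, where \<open>\<L>\<close> and \<open>\<R>\<close> trade places
  and the order of the \<open>\<D>\<close>-classes is reversed.\<close>

context skew_lattice
begin

lemma meet_left_idem: "a \<sqinter> (a \<sqinter> b) = a \<sqinter> b"
  by (metis meet.assoc meet_idem)

text \<open>Doubling the outer letter \<open>x'\<close> in the normal law leaves only products of
  \<open>x\<close> and \<open>x'\<close> between the outer letters, which \<open>\<L>\<close>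
  collapses.\<close>

lemma normal_greenL_meet_eq:
  assumes "normal_op meet" "(x, x') \<in> greenL meet"
  shows "a \<sqinter> x = a \<sqinter> x'"
proof -
  have "a \<sqinter> x \<sqinter> x' \<sqinter> x' = a \<sqinter> x' \<sqinter> x \<sqinter> x'"
    using assms(1) unfolding normal_op_def by blast
  with assms(2) show ?thesis
    by (simp add: greenL_def meet.assoc meet_idem)
qed

lemma normal_greenR_meet_eq:
  assumes "normal_op meet" "(x, x') \<in> greenR meet"
  shows "x \<sqinter> a = x' \<sqinter> a"
proof -
  have "x' \<sqinter> x' \<sqinter> x \<sqinter> a = x' \<sqinter> x \<sqinter> x' \<sqinter> a"
    using assms(1) unfolding normal_op_def by blast
  with assms(2) show ?thesis
    by (simp add: greenR_def meet_idem)
qed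

text \<open>The identity makes \<open>a \<mapsto> u \<sqinter> a \<sqinter> u\<close> a homomorphism
  (\<open>hom\<close>), so adjacent letters may be exchanged between two occurrences of
  \<open>u\<close>. Idempotence supplies the second occurrence.\<close>

lemma normal_if_meet_aba_commute:
  assumes comm: "\<And>x y z. x \<sqinter> y \<sqinter> z \<sqinter> x = x \<sqinter> z \<sqinter> y \<sqinter> x"
  shows "normal_op meet"
  unfolding normal_op_def
proof (intro allI)
  fix x y z w
  have hom: "(u \<sqinter> a \<sqinter> u) \<sqinter> (u \<sqinter> b \<sqinter> u) = u \<sqinter> a \<sqinter> b \<sqinter> u" for u a b
    using comm[of u a "u \<sqinter> b"] comm[of u b a] by (simp add: meet.assoc meet_left_idem meet_idem)
  have inner: "u \<sqinter> a \<sqinter> b \<sqinter> c \<sqinter> u = u \<sqinter> b \<sqinter> a \<sqinter> c \<sqinter> u" for u a b c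
    using hom[of u "a \<sqinter> b" c] hom[of u "b \<sqinter> a" c] comm[of u a b]
    by (simp only: meet.assoc[symmetric])
  have inner': "u \<sqinter> c \<sqinter> a \<sqinter> b \<sqinter> u = u \<sqinter> c \<sqinter> b \<sqinter> a \<sqinter> u" for u a b c
    using hom[of u c "a \<sqinter> b"] hom[of u c "b \<sqinter> a"] comm[of u a b] by (simp add: meet.assoc)
  \<comment> \<open>Square the word. The first \<open>y\<close>, \<open>z\<close> then stand between
    two \<open>x\<close>, the last ones between two \<open>w\<close>, so both pairs can be exchanged
    before the square is undone.\<close>
  have "x \<sqinter> y \<sqinter> z \<sqinter> w = (x \<sqinter> y \<sqinter> z \<sqinter> w \<sqinter> x) \<sqinter> (y \<sqinter> z \<sqinter> w)"
    using meet_idem[of "x \<sqinter> y \<sqinter> z \<sqinter> w"] by (simp only: meet.assoc)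
  also have "\<dots> = (x \<sqinter> z \<sqinter> y) \<sqinter> (w \<sqinter> x \<sqinter> y \<sqinter> z \<sqinter> w)"
    by (simp only: inner[of x y z w]) (simp only: meet.assoc)
  also have "\<dots> = x \<sqinter> z \<sqinter> y \<sqinter> w"
    using meet_idem[of "x \<sqinter> z \<sqinter> y \<sqinter> w"]
    by (simp only: inner'[of w x y z]) (simp only: meet.assoc)
  finally show "x \<sqinter> y \<sqinter> z \<sqinter> w = x \<sqinter> z \<sqinter> y \<sqinter> w" .
qed

lemma greenD_meet_commute: "(x \<sqinter> y, y \<sqinter> x) \<in> greenD meet"
proof -
  have "a \<sqinter> b \<sqinter> (b \<sqinter> a) \<sqinter> (a \<sqinter> b) = a \<sqinter> b" for a b
    using meet_idem[of "a \<sqinter> b"] by (simp add: meet.assoc meet_left_idem)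
  then show ?thesis
    by (simp add: greenD_def)
qed

lemma below_unique_if_coset_conditions:
  assumes cosets: "\<And>A B x x'. A \<in> D_classes meet \<Longrightarrow> B \<in> D_classes meet \<Longrightarrow> class_gt meet A B \<Longrightarrow>
      x \<in> B \<Longrightarrow> x' \<in> B \<Longrightarrow>
      ((x, x') \<in> greenL meet \<longrightarrow> {a \<sqinter> x |a. a \<in> A} = {a \<sqinter> x' |a. a \<in> A}) \<and>
      ((x, x') \<in> greenR meet \<longrightarrow> {x \<sqinter> a |a. a \<in> A} = {x' \<sqinter> a |a. a \<in> A})"
    and D: "(b, b') \<in> greenD meet"
    and below: "a \<sqinter> b = b" "b \<sqinter> a = b" "a \<sqinter> b' = b'" "b' \<sqinter> a = b'"
  shows "b = b'"
proof -
  let ?A = "greenD meet `` {a}" and ?B = "greenD meet `` {b}"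
  have le: "class_op meet meet ?A ?B = ?B"
    by (simp add: class_op_classes below)
  have self: "(x, x) \<in> greenD meet" for x
    by (simp add: greenD_def meet_idem)
  show ?thesis
  proof (cases "?A = ?B")
    \<comment> \<open>The order of the classes is strict, so \<open>cosets\<close> says nothing
      here; but \<open>a = a \<sqinter> b \<sqinter> a = b\<close>, and likewise
      \<open>a = b'\<close>.\<close>
    case True
    then have "(a, b) \<in> greenD meet" "(a, b') \<in> greenD meet"
      using D self[of b] by auto
    then show ?thesis
      using below by (simp add: greenD_def)
  next
    case False
    with le have gt: "class_gt meet ?A ?B"
      by (simp add: class_gt_def)
    have classes: "?A \<in> D_classes meet" "?B \<in> D_classes meet"
      by (simp_all add: quotientI)
    let ?x = "b \<sqinter> b'"
    have bb: "b \<sqinter> b' \<sqinter> b = b" "b' \<sqinter> b \<sqinter> b' = b'"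
      using D by (simp_all add: greenD_def)
    have x: "(b, ?x) \<in> greenR meet" "(?x, b') \<in> greenL meet"
      using bb by (simp_all add: greenR_def greenL_def meet.assoc meet_left_idem meet_idem)
    have xB: "?x \<in> ?B"
      using bb by (simp add: greenD_def meet.assoc meet_left_idem meet_idem)
    have xa: "a \<sqinter> ?x = ?x" "?x \<sqinter> a = ?x"
      using below by (simp_all add: meet.assoc[symmetric]) (simp add: meet.assoc below)
    have "{b \<sqinter> c |c. c \<in> ?A} = {?x \<sqinter> c |c. c \<in> ?A}"
      using cosets[OF classes gt _ xB, of b] x(1) self[of b] by simp
    moreover have "b \<in> {b \<sqinter> c |c. c \<in> ?A}"
      using below(2) self[of a] by force
    ultimately obtain c where c: "b = ?x \<sqinter> c" "(a, c) \<in> greenD meet"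
      by auto
    \<comment> \<open>As \<open>?x\<close> absorbs \<open>a\<close> on the right, the product is
      \<open>?x \<sqinter> c \<sqinter> a = b \<sqinter> a\<close>.\<close>
    have "?x = ?x \<sqinter> (a \<sqinter> c \<sqinter> a)"
      using c(2) xa by (simp add: greenD_def)
    also have "\<dots> = b"
      using c(1) xa below(2) by (metis meet.assoc)
    finally have 1: "?x = b" .
    have "{c \<sqinter> ?x |c. c \<in> ?A} = {c \<sqinter> b' |c. c \<in> ?A}"
      using cosets[OF classes gt xB, of b'] x(2) D by simp
    moreover have "?x \<in> {c \<sqinter> ?x |c. c \<in> ?A}"
      using xa(1) self[of a] by force
    ultimately obtain d where d: "?x = d \<sqinter> b'" "(a, d) \<in> greenD meet"
      by auto
    have "b' = (a \<sqinter> d \<sqinter> a) \<sqinter> b'"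
      using d(2) below by (simp add: greenD_def)
    also have "\<dots> = ?x"
      using d(1) xa below(3) by (metis meet.assoc)
    finally show ?thesis
      using 1 by simp
  qed
qed

lemma normal_iff_cosets:
  "normal_op meet \<longleftrightarrow>
     (\<forall>A \<in> D_classes meet. \<forall>B \<in> D_classes meet. class_gt meet A B \<longrightarrow>
       (\<forall>x \<in> B. \<forall>x' \<in> B.
         ((x, x') \<in> greenL meet \<longrightarrow> {a \<sqinter> x |a. a \<in> A} = {a \<sqinter> x' |a. a \<in> A}) \<and>
         ((x, x') \<in> greenR meet \<longrightarrow> {x \<sqinter> a |a. a \<in> A} = {x' \<sqinter> a |a. a \<in> A})))"
  (is "_ \<longleftrightarrow> ?cosets")
proof
  assume n: "normal_op meet"
  show ?cosets
    by (simp add: normal_greenL_meet_eq[OF n] normal_greenR_meet_eq[OF n] cong: conj_cong)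
next
  assume ?cosets
  then have unique: "b = b'"
    if "(b, b') \<in> greenD meet" "a \<sqinter> b = b" "b \<sqinter> a = b" "a \<sqinter> b' = b'" "b' \<sqinter> a = b'" for a b b'
    by (intro below_unique_if_coset_conditions[OF _ that]) blast
  show "normal_op meet"
  proof (rule normal_if_meet_aba_commute)
    fix x y z
    \<comment> \<open>Both elements lie below \<open>x\<close>, so \<open>unique\<close> applies
      with \<open>a = x\<close> once they are \<D>-related.\<close>
    have "(x \<sqinter> (y \<sqinter> z) \<sqinter> x, x \<sqinter> (z \<sqinter> y) \<sqinter> x) \<in> greenD meet"
      by (intro greenD_meet_cong greenD_meet_commute) (simp_all add: greenD_def meet_idem)
    then have "x \<sqinter> (y \<sqinter> z) \<sqinter> x = x \<sqinter> (z \<sqinter> y) \<sqinter> x"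
      by (rule unique[where a = x]) (simp_all add: meet.assoc meet_left_idem meet_idem)
    then show "x \<sqinter> y \<sqinter> z \<sqinter> x = x \<sqinter> z \<sqinter> y \<sqinter> x"
      by (simp add: meet.assoc)
  qed
qed

lemma greenL_join: "greenL join = greenR meet"
  by (auto simp: greenR_iff_join) (auto simp: greenL_def)

lemma greenR_join: "greenR join = greenL meet"
  by (auto simp: greenL_iff_join) (auto simp: greenR_def)

lemma greenD_join: "greenD join = greenD meet"
  by (auto simp: greenD_iff_join) (auto simp: greenD_def)

text \<open>From \<open>y \<D> x \<sqinter> y\<close>, joining with \<open>x\<close> gives
  \<open>y \<squnion> x \<D> (x \<sqinter> y) \<squnion> x\<close>. This join is \<D>-related to the
  one in the other order, which absorption reduces to \<open>x\<close>.\<close>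

lemma class_gt_meet_imp_join:
  assumes "A \<in> D_classes meet" "B \<in> D_classes meet" "class_gt meet A B"
  shows "class_gt join B A"
proof -
  obtain x y where A: "A = greenD meet `` {x}" and B: "B = greenD meet `` {y}"
    using assms(1,2) by (auto elim!: quotientE)
  have "greenD meet `` {x \<sqinter> y} = greenD meet `` {y}"
    using assms(3) by (simp add: class_gt_def A B class_op_classes)
  then have "(y, x \<sqinter> y) \<in> greenD meet"
    using eq_equiv_class[OF _ equiv_greenD] by fastforce
  then have "(y \<squnion> x, (x \<sqinter> y) \<squnion> x) \<in> greenD meet"
    by (rule greenD_join_cong) (simp add: greenD_def meet_idem)
  moreover have "((x \<sqinter> y) \<squnion> x, x \<squnion> (x \<sqinter> y)) \<in> greenD meet"
    using skew_lattice.greenD_meet_commute[OF dual_skew_lattice] greenD_join by simp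
  ultimately have "greenD meet `` {y \<squnion> x} = greenD meet `` {x}"
    using equiv_class_eq[OF equiv_greenD] by (simp add: join_meet_absorb_left)
  then show ?thesis
    using assms(3) skew_lattice.class_op_classes(1)[OF dual_skew_lattice, of y x]
    by (auto simp: class_gt_def A B greenD_join)
qed

text \<open>The converse is the previous lemma in the dual skew lattice, which has the same
  \<D>-classes.\<close>

lemma class_gt_join_iff:
  assumes "A \<in> D_classes meet" "B \<in> D_classes meet"
  shows "class_gt join B A \<longleftrightarrow> class_gt meet A B"
  using assms class_gt_meet_imp_join
    skew_lattice.class_gt_meet_imp_join[OF dual_skew_lattice, of B A]
  by (auto simp: greenD_join)

lemma conormal_iff_cosets:
  "normal_op join \<longleftrightarrow>
     (\<forall>A \<in> D_classes meet. \<forall>B \<in> D_classes meet. class_gt meet A B \<longrightarrow>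
       (\<forall>x \<in> A. \<forall>x' \<in> A.
         ((x, x') \<in> greenR meet \<longrightarrow> {b \<squnion> x |b. b \<in> B} = {b \<squnion> x' |b. b \<in> B}) \<and>
         ((x, x') \<in> greenL meet \<longrightarrow> {x \<squnion> b |b. b \<in> B} = {x' \<squnion> b |b. b \<in> B})))"
  \<comment> \<open>The dual criterion takes elements of the lower class in the order of
    \<open>join\<close>, which is the upper class \<open>A\<close> for \<open>meet\<close>; hence
    the bound classes are exchanged.\<close>
  unfolding skew_lattice.normal_iff_cosets[OF dual_skew_lattice] greenD_join greenL_join greenR_join
  using class_gt_join_iff by blast

end

theorem proposition3p1:
  fixes join meet :: "'a \<Rightarrow> 'a \<Rightarrow> 'a"
  assumes "skew_lattice join meet"
  shows
    "(normal_op meet \<longleftrightarrow>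
       (\<forall>A \<in> D_classes meet. \<forall>B \<in> D_classes meet. class_gt meet A B \<longrightarrow>
         (\<forall>x \<in> B. \<forall>x' \<in> B.
           ((x, x') \<in> greenL meet \<longrightarrow> {meet a x |a. a \<in> A} = {meet a x' |a. a \<in> A}) \<and>
           ((x, x') \<in> greenR meet \<longrightarrow> {meet x a |a. a \<in> A} = {meet x' a |a. a \<in> A}))))
     \<and>
     (normal_op join \<longleftrightarrow>
       (\<forall>A \<in> D_classes meet. \<forall>B \<in> D_classes meet. class_gt meet A B \<longrightarrow>
         (\<forall>x \<in> A. \<forall>x' \<in> A.
           ((x, x') \<in> greenR meet \<longrightarrow> {join b x |b. b \<in> B} = {join b x' |b. b \<in> B}) \<and>
           ((x, x') \<in> greenL meet \<longrightarrow> {join x b |b. b \<in> B} = {join x' b |b. b \<in> B}))))"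
  using skew_lattice.normal_iff_cosets[OF assms] skew_lattice.conormal_iff_cosets[OF assms]
  by (rule conjI)

end
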